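(* Let $d\in\{2,3\}$, $N\ge 2$, and let $\mathbf{x}=(\mathbf{x}_1,\dots,\mathbf{x}_N)$ be a solution, on $[0,\infty)$, of the Lennard-Jones driven system $$m_i\ddot{\mathbf{x}}_i(t)+c_i\dot{\mathbf{x}}_i(t)=-\nabla_{\mathbf{x}_i}U(\mathbf{x}_1(t),\dots,\mathbf{x}_N(t)),\qquad i=1,\dots,N,$$ where $m_i>0$, $c_i>0$ and $U$ is the total Lennard-Jones potential defined in the context, with collision-free initial data, i.e. $\mathbf{x}_i(0)\neq\mathbf{x}_j(0)$ for all $i\ne j$. Let $$E_0=\frac12\sum_{i=1}^N m_i\|\dot{\mathbf{x}}_i(0)\|^2+U(\mathbf{x}_1(0),\dots,\mathbf{x}_N(0)),\qquad \sigma_{\min}=\min_{i<j}\sigma_{ij}.$$ Then for all $t\ge 0$, $$\min_{i<j}\|\mathbf{x}_i(t)-\mathbf{x}_j(t)\|\;\ge\;\left(\frac{2a\,\sigma_{\min}^{12}}{E_0+2a\binom{N}{2}}\right)^{1/12}>0 .$$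
   Context: Each agent $i\in\{1,\dots,N\}$ has position $\mathbf{x}_i\in\mathbb{R}^d$, mass $m_i>0$, damping coefficient $c_i>0$ and radius $q_i>0$. For $i\ne j$ put $\sigma_{ij}=\frac{q_i+q_j}{2}$ and $r_{ij}=\|\mathbf{x}_i-\mathbf{x}_j\|$ (Euclidean norm). With a constant $a>0$, the pair potential is $$\phi(\sigma_{ij},r_{ij})=4a\left[\left(\frac{\sigma_{ij}}{r_{ij}}\right)^{12}-\left(\frac{\sigma_{ij}}{r_{ij}}\right)^{6}\right],\qquad r_{ij}>0,$$ and the total potential is $$U(\mathbf{x}_1,\dots,\mathbf{x}_N)=\sum_{i=1}^{N-1}\sum_{j=i+1}^{N}\phi(\sigma_{ij},\|\mathbf{x}_i-\mathbf{x}_j\|).$$ The collision set is $\mathcal{C}=\{\mathbf{x}\in\mathbb{R}^{dN}: \mathbf{x}_i=\mathbf{x}_j\text{ for some } i\ne j\}$; $U$ is defined and smooth on $\mathbb{R}^{dN}\setminus\mathcal{C}$. A solution is a twice continuously differentiable curve taking values in $\mathbb{R}^{dN}\setminus\mathcal{C}$ and satisfying the system (one-sided derivatives at $t=0$). *)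

theory Defs
  imports "HOL-Analysis.Analysis"
begin

text \<open>
  Agents are labelled \<open>1, \<dots>, N\<close>, and a configuration is a function
  \<open>X :: nat \<Rightarrow> real ^ 'd\<close> of which only the values on \<open>{1..N}\<close> matter.
\<close>

definition pair_sigma :: "(nat \<Rightarrow> real) \<Rightarrow> nat \<Rightarrow> nat \<Rightarrow> real" where
  "pair_sigma q i j = (q i + q j) / 2"

definition lj_potential :: "real \<Rightarrow> real \<Rightarrow> real \<Rightarrow> real" where
  "lj_potential a s r = 4 * a * ((s / r) ^ 12 - (s / r) ^ 6)"

definition total_potential ::
    "real \<Rightarrow> (nat \<Rightarrow> real) \<Rightarrow> nat \<Rightarrow> (nat \<Rightarrow> real ^ 'd) \<Rightarrow> real" where
  "total_potential a q N X =
     (\<Sum>i = 1..N - 1. \<Sum>j = i + 1..N. lj_potential a (pair_sigma q i j) (norm (X i - X j)))"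

definition collision_set :: "nat \<Rightarrow> (nat \<Rightarrow> real ^ 'd) set" where
  "collision_set N = {X. \<exists>i\<in>{1..N}. \<exists>j\<in>{1..N}. i \<noteq> j \<and> X i = X j}"

definition partial_grad ::
    "((nat \<Rightarrow> real ^ 'd) \<Rightarrow> real) \<Rightarrow> nat \<Rightarrow> (nat \<Rightarrow> real ^ 'd) \<Rightarrow> real ^ 'd" where
  "partial_grad F i X = (THE D. GDERIV (\<lambda>y. F (X(i := y))) (X i) :> D)"

text \<open>
  Derivatives of a curve on \<open>[0, \<infinity>)\<close>. Taking them within \<open>{0..}\<close> makes them
  one-sided at \<open>0\<close> and ordinary two-sided derivatives at every \<open>t > 0\<close>.
\<close>

definition vel :: "(real \<Rightarrow> real ^ 'd) \<Rightarrow> real \<Rightarrow> real ^ 'd" where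
  "vel y t = vector_derivative y (at t within {0..})"

definition acc :: "(real \<Rightarrow> real ^ 'd) \<Rightarrow> real \<Rightarrow> real ^ 'd" where
  "acc y t = vector_derivative (vel y) (at t within {0..})"

definition C2_halfline :: "(real \<Rightarrow> real ^ 'd) \<Rightarrow> bool" where
  "C2_halfline y \<longleftrightarrow>
     y differentiable_on {0..} \<and> vel y differentiable_on {0..} \<and> continuous_on {0..} (acc y)"

definition lj_solution ::
    "real \<Rightarrow> (nat \<Rightarrow> real) \<Rightarrow> (nat \<Rightarrow> real) \<Rightarrow> (nat \<Rightarrow> real) \<Rightarrow> nat \<Rightarrow>
     (real \<Rightarrow> nat \<Rightarrow> real ^ 'd) \<Rightarrow> bool" where
  "lj_solution a m c q N x \<longleftrightarrow>
     (\<forall>i\<in>{1..N}. C2_halfline (\<lambda>t. x t i)) \<and>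
     (\<forall>t\<ge>0. x t \<notin> collision_set N) \<and>
     (\<forall>t\<ge>0. \<forall>i\<in>{1..N}.
        m i *\<^sub>R acc (\<lambda>s. x s i) t + c i *\<^sub>R vel (\<lambda>s. x s i) t =
          - partial_grad (total_potential a q N) i (x t))"

definition initial_energy ::
    "real \<Rightarrow> (nat \<Rightarrow> real) \<Rightarrow> (nat \<Rightarrow> real) \<Rightarrow> nat \<Rightarrow> (real \<Rightarrow> nat \<Rightarrow> real ^ 'd) \<Rightarrow> real" where
  "initial_energy a m q N x =
     1 / 2 * (\<Sum>i = 1..N. m i * (norm (vel (\<lambda>s. x s i) 0))\<^sup>2) + total_potential a q N (x 0)"

definition min_over_pairs :: "nat \<Rightarrow> (nat \<Rightarrow> nat \<Rightarrow> real) \<Rightarrow> real" where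
  "min_over_pairs N f = Min {f i j | i j. 1 \<le> i \<and> i < j \<and> j \<le> N}"

end

theory Submission
  imports Defs
begin

text \<open>
  The energy \<open>1/2 \<Sum>\<^sub>i m\<^sub>i |v\<^sub>i|\<^sup>2 + U\<close> has derivative \<open>- \<Sum>\<^sub>i c\<^sub>i |v\<^sub>i|\<^sup>2\<close> along a solution, so
  \<open>U(x(t)) \<le> E\<^sub>0\<close>. With \<open>u = (\<sigma>/r)\<^sup>6\<close>, the inequality \<open>4 (u\<^sup>2 - u) = 2 u\<^sup>2 - 2 + 2 (u - 1)\<^sup>2 \<ge> 2 u\<^sup>2 - 2\<close>
  bounds every pair potential below both by \<open>2a ((\<sigma>/r)\<^sup>1\<^sup>2 - 1)\<close> and by \<open>-2a\<close>. Keeping the first bound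
  for one pair and the second for the others gives \<open>2a (\<sigma>/r)\<^sup>1\<^sup>2 \<le> E\<^sub>0 + 2a (N choose 2)\<close>.
\<close>

section \<open>Sums and minima over pairs of agents\<close>

definition agent_pairs :: "nat \<Rightarrow> (nat \<times> nat) set" where
  "agent_pairs N = (SIGMA i:{1..N - 1}. {i + 1..N})"

lemma finite_agent_pairs [simp]: "finite (agent_pairs N)"
  by (simp add: agent_pairs_def)

lemma mem_agent_pairs_iff: "(i, j) \<in> agent_pairs N \<longleftrightarrow> 1 \<le> i \<and> i < j \<and> j \<le> N"
  by (auto simp: agent_pairs_def)

lemma agent_pairs_nonempty: "N \<ge> 2 \<Longrightarrow> agent_pairs N \<noteq> {}"
  using mem_agent_pairs_iff[of 1 2 N] by auto

lemma collision_free_pair: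
  assumes "X \<notin> collision_set N" "(i, j) \<in> agent_pairs N"
  shows "X i \<noteq> X j"
proof -
  have "i \<in> {1..N}" "j \<in> {1..N}" "i \<noteq> j"
    using assms(2) by (auto simp: mem_agent_pairs_iff)
  then show ?thesis
    using assms(1) unfolding collision_set_def by blast
qed

lemma card_agent_pairs: "card (agent_pairs N) = N choose 2"
proof -
  have "card (agent_pairs N) = (\<Sum>i = 1..N - 1. N - i)"
    by (simp add: agent_pairs_def)
  also have "\<dots> = (\<Sum>i = 1..N - 1. i)"
    \<comment> \<open>The reflection \<open>i \<mapsto> N - i\<close> is an involution of
      \<open>{1..N - 1}\<close>; what remains is the Gauss sum up to \<open>N - 1\<close>.\<close>
    by (rule sum.reindex_bij_witness[of _ "\<lambda>i. N - i" "\<lambda>i. N - i"]) auto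
  also have "\<dots> = N choose 2"
    using gauss_sum_nat[of "N - 1"]
    by (cases N) (simp_all add: choose_two mult.commute atLeast1_atMost_eq_remove0 atMost_atLeast0 sum_diff1_nat)
  finally show ?thesis .
qed

lemma min_over_pairs_eq: "min_over_pairs N f = Min (case_prod f ` agent_pairs N)"
  unfolding min_over_pairs_def
  by (rule arg_cong[of _ _ Min]) (auto simp: mem_agent_pairs_iff image_iff; blast)

text \<open>With the nested sum flattened to one finite index set, the potential can be
  differentiated term by term and a single pair can be split off.\<close>

lemma total_potential_eq:
  "total_potential a q N X =
    (\<Sum>(i, j)\<in>agent_pairs N. lj_potential a (pair_sigma q i j) (norm (X i - X j)))"
  by (simp add: total_potential_def agent_pairs_def sum.Sigma)

subsection \<open>The gradient of the potential\<close>

definition lj_potential_deriv :: "real \<Rightarrow> real \<Rightarrow> real \<Rightarrow> real" where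
  "lj_potential_deriv a s r = 4 * a * (12 * (s / r) ^ 11 - 6 * (s / r) ^ 5) * - (s / r\<^sup>2)"

text \<open>Gradient of the radial function \<open>\<lambda>z. lj_potential a s (norm z)\<close> for
  \<open>z \<noteq> 0\<close>: the gradient of the norm there is \<open>sgn z\<close>.\<close>

definition lj_gradient :: "real \<Rightarrow> real \<Rightarrow> real ^ 'd \<Rightarrow> real ^ 'd" where
  "lj_gradient a s z = lj_potential_deriv a s (norm z) *\<^sub>R sgn z"

lemma lj_potential_has_real_derivative:
  assumes "r \<noteq> 0"
  shows "(lj_potential a s has_real_derivative lj_potential_deriv a s r) (at r)"
proof -
  have d: "((\<lambda>r. s / r) has_real_derivative - (s / r\<^sup>2)) (at r)"
    using assms by (auto intro!: derivative_eq_intros simp: power2_eq_square)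
  show ?thesis
    unfolding lj_potential_def[abs_def]
    by (rule DERIV_cong[OF DERIV_cmult[OF DERIV_diff[OF DERIV_power[OF d] DERIV_power[OF d]]]])
      (simp add: lj_potential_deriv_def algebra_simps)
qed

lemma lj_potential_norm_has_derivative:
  fixes z :: "real ^ 'd"
  assumes "z \<noteq> 0"
  shows "((\<lambda>z. lj_potential a s (norm z)) has_derivative (\<lambda>h. h \<bullet> lj_gradient a s z)) (at z)"
  using GDERIV_DERIV_compose[OF GDERIV_norm[OF assms]
      lj_potential_has_real_derivative[of "norm z" a s]] assms
  by (simp add: gderiv_def lj_gradient_def)

text \<open>The domain of \<open>f\<close> is left general because two maps are plugged in later:
  the variation \<open>\<lambda>y. X(k := y)\<close> of one agent, which yields the partial
  gradients, and the trajectory in time, which yields the chain rule.\<close>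

lemma total_potential_has_derivative:
  fixes f :: "'b::real_normed_vector \<Rightarrow> nat \<Rightarrow> real ^ 'd"
  assumes nc: "f t \<notin> collision_set N"
    and f: "\<And>i. i \<in> {1..N} \<Longrightarrow> ((\<lambda>s. f s i) has_derivative f' i) (at t within S)"
  shows "((\<lambda>s. total_potential a q N (f s)) has_derivative
     (\<lambda>h. \<Sum>(i, j)\<in>agent_pairs N. (f' i h - f' j h) \<bullet> lj_gradient a (pair_sigma q i j) (f t i - f t j)))
     (at t within S)"
proof -
  have "((\<lambda>s. lj_potential a (pair_sigma q i j) (norm (f s i - f s j))) has_derivative
      (\<lambda>h. (f' i h - f' j h) \<bullet> lj_gradient a (pair_sigma q i j) (f t i - f t j))) (at t within S)"
    if "(i, j) \<in> agent_pairs N" for i j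
  proof -
    have ij: "i \<in> {1..N}" "j \<in> {1..N}"
      using that by (auto simp: mem_agent_pairs_iff)
    have "f t i - f t j \<noteq> 0"
      using collision_free_pair[OF nc that] by simp
    from has_derivative_compose[OF has_derivative_diff[OF f[OF ij(1)] f[OF ij(2)]]
        lj_potential_norm_has_derivative[OF this]]
    show ?thesis .
  qed
  then show ?thesis
    unfolding total_potential_eq by (auto simp: case_prod_beta intro!: has_derivative_sum)
qed

text \<open>Signed incidence matrix of the complete graph on the agents. It records that a pair
  interaction acts on its two agents with opposite signs.\<close>

definition pair_sign :: "nat \<Rightarrow> nat \<times> nat \<Rightarrow> real" where
  "pair_sign k p = of_bool (fst p = k) - of_bool (snd p = k)"

lemma sum_pair_sign:
  fixes v :: "nat \<Rightarrow> real ^ 'd"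
  assumes "p \<in> agent_pairs N"
  shows "(\<Sum>k = 1..N. pair_sign k p *\<^sub>R v k) = v (fst p) - v (snd p)"
proof -
  have "fst p \<in> {1..N}" "snd p \<in> {1..N}"
    using assms by (cases p; simp add: mem_agent_pairs_iff)+
  then show ?thesis
    by (simp add: pair_sign_def scaleR_diff_left sum_subtractf of_bool_def if_distrib[of "\<lambda>r. r *\<^sub>R _"] cong: if_cong)
qed

text \<open>\<open>partial_grad\<close> is a definite description, so uniqueness is the point: the
  derivative at a point is unique, and a vector is determined by its inner products with all
  vectors.\<close>

lemma partial_grad_eqI:
  assumes "GDERIV (\<lambda>y. F (X(i := y))) (X i) :> D"
  shows "partial_grad F i X = D"
  unfolding partial_grad_def
proof (rule the_equality)
  show "GDERIV (\<lambda>y. F (X(i := y))) (X i) :> D" by (fact assms)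
next
  fix D' assume "GDERIV (\<lambda>y. F (X(i := y))) (X i) :> D'"
  with assms have "(\<lambda>h. h \<bullet> D') = (\<lambda>h. h \<bullet> D)"
    unfolding gderiv_def by (rule has_derivative_unique[rotated])
  then show "D' = D"
    by (simp add: fun_eq_iff vector_eq_ldot)
qed

lemma partial_grad_total_potential:
  fixes X :: "nat \<Rightarrow> real ^ 'd"
  assumes "X \<notin> collision_set N"
  shows "partial_grad (total_potential a q N) k X =
    (\<Sum>p\<in>agent_pairs N. pair_sign k p *\<^sub>R
       lj_gradient a (pair_sigma q (fst p) (snd p)) (X (fst p) - X (snd p)))"
proof (rule partial_grad_eqI)
  \<comment> \<open>Only component \<open>k\<close> moves, so the difference of components
    \<open>i\<close> and \<open>j\<close> varies with factor
    \<open>pair_sign k (i, j)\<close>.\<close>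
  have "((\<lambda>y. (X(k := y)) i) has_derivative (\<lambda>h. of_bool (i = k) *\<^sub>R h)) (at (X k))" for i
    by (cases "i = k") (auto intro!: derivative_eq_intros)
  from total_potential_has_derivative[of "\<lambda>y. X(k := y)", OF _ this, where N = N and a = a and q = q] assms
  show "GDERIV (\<lambda>y. total_potential a q N (X(k := y))) (X k) :>
    (\<Sum>p\<in>agent_pairs N. pair_sign k p *\<^sub>R
       lj_gradient a (pair_sigma q (fst p) (snd p)) (X (fst p) - X (snd p)))"
    unfolding gderiv_def
    by (simp add: case_prod_beta pair_sign_def inner_sum_right inner_diff_left
        left_diff_distrib del: fun_upd_apply)
qed

text \<open>Double counting: exchanging the sums over agents and pairs turns velocities paired with
  partial gradients into relative velocities paired with pair gradients, which is what
  differentiating pair by pair produces.\<close>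

lemma total_potential_has_vector_derivative:
  fixes x :: "real \<Rightarrow> nat \<Rightarrow> real ^ 'd"
  assumes nc: "x t \<notin> collision_set N"
    and x: "\<And>i. i \<in> {1..N} \<Longrightarrow> ((\<lambda>s. x s i) has_vector_derivative v i) (at t within S)"
  shows "((\<lambda>s. total_potential a q N (x s)) has_real_derivative
     (\<Sum>k = 1..N. v k \<bullet> partial_grad (total_potential a q N) k (x t))) (at t within S)"
proof -
  let ?G = "\<lambda>p. lj_gradient a (pair_sigma q (fst p) (snd p)) (x t (fst p) - x t (snd p))"
  have "(\<Sum>k = 1..N. v k \<bullet> partial_grad (total_potential a q N) k (x t)) =
      (\<Sum>k = 1..N. \<Sum>p\<in>agent_pairs N. (pair_sign k p *\<^sub>R v k) \<bullet> ?G p)"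
    by (simp add: partial_grad_total_potential[OF nc] inner_sum_right)
  also have "\<dots> = (\<Sum>p\<in>agent_pairs N. (\<Sum>k = 1..N. pair_sign k p *\<^sub>R v k) \<bullet> ?G p)"
    by (subst sum.swap) (simp add: inner_sum_left)
  also have "\<dots> = (\<Sum>p\<in>agent_pairs N. (v (fst p) - v (snd p)) \<bullet> ?G p)"
    by (simp add: sum_pair_sign del: One_nat_def)
  finally have eq: "(\<Sum>k = 1..N. v k \<bullet> partial_grad (total_potential a q N) k (x t)) = \<dots>" .
  have "((\<lambda>s. total_potential a q N (x s)) has_derivative
     (\<lambda>h. \<Sum>(i, j)\<in>agent_pairs N. (h *\<^sub>R v i - h *\<^sub>R v j) \<bullet> lj_gradient a (pair_sigma q i j) (x t i - x t j)))
     (at t within S)"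
    using x by (intro total_potential_has_derivative nc) (simp add: has_vector_derivative_def)
  then show ?thesis
    unfolding eq has_field_derivative_def
    by (rule has_derivative_eq_rhs)
      (simp add: fun_eq_iff case_prod_beta sum_distrib_left mult.commute flip: scaleR_diff_right)
qed

subsection \<open>Energy dissipation\<close>

lemma C2_halfline_has_vector_derivative:
  assumes "C2_halfline y" "t \<ge> 0"
  shows "(y has_vector_derivative vel y t) (at t within {0..})"
    and "(vel y has_vector_derivative acc y t) (at t within {0..})"
  using assms unfolding C2_halfline_def vel_def[of y t] acc_def differentiable_on_def
  by (auto simp: vector_derivative_works[symmetric])

definition energy ::
    "real \<Rightarrow> (nat \<Rightarrow> real) \<Rightarrow> (nat \<Rightarrow> real) \<Rightarrow> nat \<Rightarrow> (real \<Rightarrow> nat \<Rightarrow> real ^ 'd) \<Rightarrow> real \<Rightarrow> real" where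
  "energy a m q N x t =
     1 / 2 * (\<Sum>i = 1..N. m i * (norm (vel (\<lambda>s. x s i) t))\<^sup>2) + total_potential a q N (x t)"

text \<open>Kinetic and potential parts combine to the inner products of \<open>v\<^sub>i\<close>
  with \<open>m\<^sub>i a\<^sub>i + g\<^sub>i\<close>, where \<open>g\<^sub>i\<close> is the partial
  gradient; the equation of motion replaces the second factor by
  \<open>- c\<^sub>i v\<^sub>i\<close>, leaving only damping.\<close>

lemma energy_has_real_derivative:
  fixes x :: "real \<Rightarrow> nat \<Rightarrow> real ^ 'd"
  assumes sol: "lj_solution a m c q N x" and t: "t \<ge> 0"
  shows "(energy a m q N x has_real_derivative
     - (\<Sum>i = 1..N. c i * (norm (vel (\<lambda>s. x s i) t))\<^sup>2)) (at t within {0..})"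
proof -
  let ?v = "\<lambda>i. vel (\<lambda>s. x s i)" and ?a = "\<lambda>i. acc (\<lambda>s. x s i)"
  let ?g = "\<lambda>i. partial_grad (total_potential a q N) i (x t)"
  have C2: "C2_halfline (\<lambda>s. x s i)" if "i \<in> {1..N}" for i
    using sol that by (simp add: lj_solution_def)
  have nc: "x t \<notin> collision_set N"
    using sol t by (simp add: lj_solution_def)
  have newton: "m i *\<^sub>R ?a i t + c i *\<^sub>R ?v i t = - ?g i" if "i \<in> {1..N}" for i
    using sol t that by (simp add: lj_solution_def)
  have kin: "((\<lambda>s. m i * (norm (?v i s))\<^sup>2) has_real_derivative 2 * (m i * (?v i t \<bullet> ?a i t)))
      (at t within {0..})" if "i \<in> {1..N}" for i
    using C2_halfline_has_vector_derivative(2)[OF C2[OF that] t]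
    unfolding power2_norm_eq_inner has_vector_derivative_def has_field_derivative_def
    by (auto intro!: derivative_eq_intros simp: inner_commute algebra_simps fun_eq_iff)
  have "(energy a m q N x has_real_derivative
      1 / 2 * (\<Sum>i = 1..N. 2 * (m i * (?v i t \<bullet> ?a i t))) + (\<Sum>i = 1..N. ?v i t \<bullet> ?g i))
      (at t within {0..})"
    unfolding energy_def[abs_def]
    by (intro DERIV_add DERIV_cmult DERIV_sum kin total_potential_has_vector_derivative nc
        C2_halfline_has_vector_derivative(1) C2 t)
  also have "1 / 2 * (\<Sum>i = 1..N. 2 * (m i * (?v i t \<bullet> ?a i t))) + (\<Sum>i = 1..N. ?v i t \<bullet> ?g i) =
      (\<Sum>i = 1..N. ?v i t \<bullet> (m i *\<^sub>R ?a i t + ?g i))"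
    by (simp add: sum_distrib_left[symmetric] sum.distrib inner_add_right)
  also have "\<dots> = (\<Sum>i = 1..N. - (c i * (norm (?v i t))\<^sup>2))"
  proof (rule sum.cong[OF refl])
    fix i assume "i \<in> {1..N}"
    then have "m i *\<^sub>R ?a i t + ?g i = - (c i *\<^sub>R ?v i t)"
      using newton[of i] by (simp add: eq_neg_iff_add_eq_0 algebra_simps)
    then show "?v i t \<bullet> (m i *\<^sub>R ?a i t + ?g i) = - (c i * (norm (?v i t))\<^sup>2)"
      by (simp add: power2_norm_eq_inner)
  qed
  finally show ?thesis
    by (simp add: sum_negf)
qed

lemma energy_le_initial_energy:
  fixes x :: "real \<Rightarrow> nat \<Rightarrow> real ^ 'd"
  assumes sol: "lj_solution a m c q N x" and t: "t \<ge> 0"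
    and c: "\<And>i. i \<in> {1..N} \<Longrightarrow> c i \<ge> 0"
  shows "energy a m q N x t \<le> initial_energy a m q N x"
proof -
  have "energy a m q N x t \<le> energy a m q N x 0"
  \<comment> \<open>Derivatives are known within \<open>{0..}\<close>. They are two-sided at
    interior times, and at the endpoints continuity of the energy suffices.\<close>
  proof (rule DERIV_nonpos_imp_decreasing_open[OF t])
    fix s :: real assume s: "0 < s" "s < t"
    then have "at s within {0..} = at s"
      by (intro at_within_interior) simp
    moreover have "- (\<Sum>i = 1..N. c i * (norm (vel (\<lambda>s. x s i) s))\<^sup>2) \<le> 0"
      using c by (auto intro!: sum_nonneg)
    ultimately show "\<exists>y. (energy a m q N x has_real_derivative y) (at s) \<and> y \<le> 0"
      using energy_has_real_derivative[OF sol, of s] s by auto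
  next
    have "continuous_on {0..} (energy a m q N x)"
      using energy_has_real_derivative[OF sol] by (intro DERIV_continuous_on) auto
    then show "continuous_on {0..t} (energy a m q N x)"
      by (rule continuous_on_subset) auto
  qed
  then show ?thesis
    by (simp add: energy_def initial_energy_def)
qed

subsection \<open>Separation\<close>

lemma lj_potential_lower_bound:
  assumes "a \<ge> 0"
  shows "lj_potential a s r \<ge> 2 * a * (s / r) ^ 12 - 2 * a"
proof -
  \<comment> \<open>A polynomial identity in \<open>s / r\<close>, hence valid for every
    \<open>r\<close>, with \<open>s / r = 0\<close> at \<open>r = 0\<close>.\<close>
  have "lj_potential a s r - (2 * a * (s / r) ^ 12 - 2 * a) = 2 * a * ((s / r) ^ 6 - 1)\<^sup>2"
    unfolding lj_potential_def power2_diff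
    by (simp add: algebra_simps flip: power_mult)
  also have "\<dots> \<ge> 0"
    using assms by simp
  finally show ?thesis by simp
qed

lemma total_potential_lower_bound:
  assumes "a \<ge> 0" and ij: "(i, j) \<in> agent_pairs N"
  shows "total_potential a q N X \<ge>
    2 * a * (pair_sigma q i j / norm (X i - X j)) ^ 12 - 2 * a * real (N choose 2)"
proof -
  let ?u = "\<lambda>(i, j). 2 * a * (pair_sigma q i j / norm (X i - X j)) ^ 12"
  \<comment> \<open>The even power makes every term \<open>?u p\<close> nonnegative, so one of them
    is at most their sum.\<close>
  have "?u (i, j) \<le> (\<Sum>p\<in>agent_pairs N. ?u p)"
    using assms by (intro member_le_sum) auto
  moreover have "(\<Sum>p\<in>agent_pairs N. ?u p - 2 * a) \<le> total_potential a q N X"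
    unfolding total_potential_eq
    using lj_potential_lower_bound[OF assms(1)] by (intro sum_mono) auto
  ultimately show ?thesis
    by (simp add: sum_subtractf card_agent_pairs mult.commute)
qed


theorem mainTheorem2:
  fixes N :: nat
    and a :: real
    and m c q :: "nat \<Rightarrow> real"
    and x :: "real \<Rightarrow> nat \<Rightarrow> real ^ 'd"
  assumes "CARD('d) \<in> {2, 3}"
    and "N \<ge> 2"
    and "a > 0"
    and "\<And>i. i \<in> {1..N} \<Longrightarrow> m i > 0"
    and "\<And>i. i \<in> {1..N} \<Longrightarrow> c i > 0"
    and "\<And>i. i \<in> {1..N} \<Longrightarrow> q i > 0"
    and "lj_solution a m c q N x"
    and "\<And>i j. i \<in> {1..N} \<Longrightarrow> j \<in> {1..N} \<Longrightarrow> i \<noteq> j \<Longrightarrow> x 0 i \<noteq> x 0 j"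
  shows "\<forall>t\<ge>0.
    min_over_pairs N (\<lambda>i j. norm (x t i - x t j)) \<ge>
      root 12 (2 * a * min_over_pairs N (pair_sigma q) ^ 12 /
        (initial_energy a m q N x + 2 * a * real (N choose 2))) \<and>
    root 12 (2 * a * min_over_pairs N (pair_sigma q) ^ 12 /
        (initial_energy a m q N x + 2 * a * real (N choose 2))) > 0"
proof (intro allI impI)
  fix t :: real assume t: "t \<ge> 0"
  let ?\<sigma> = "min_over_pairs N (pair_sigma q)"
  let ?E = "initial_energy a m q N x + 2 * a * real (N choose 2)"
  let ?r = "\<lambda>i j. norm (x t i - x t j)"
  \<comment> \<open>Both minima are \<open>Min\<close> of a finite set, which is informative only
    when a pair exists.\<close>
  have ne: "agent_pairs N \<noteq> {}"
    using \<open>N \<ge> 2\<close> by (rule agent_pairs_nonempty)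
  have \<sigma>: "?\<sigma> > 0"
    using ne assms(6) by (auto simp: min_over_pairs_eq mem_agent_pairs_iff pair_sigma_def add_pos_pos)
  \<comment> \<open>Positivity of \<open>?E\<close> is obtained together with the bound for a pair,
    since it comes from the strictly positive term of that pair lying below \<open>?E\<close>;
    \<open>ne\<close> later supplies such a pair.\<close>
  have *: "?E > 0 \<and> root 12 (2 * a * ?\<sigma> ^ 12 / ?E) \<le> ?r i j" if ij: "(i, j) \<in> agent_pairs N" for i j
  proof -
    have "x t i \<noteq> x t j"
      using assms(7) t by (intro collision_free_pair[OF _ ij]) (simp add: lj_solution_def)
    then have r: "?r i j > 0"
      by simp
    \<comment> \<open>Passing to the smallest \<sigma> makes the bound the same for all pairs, so
      that it passes to the minimum distance.\<close>
    have "?\<sigma> \<le> pair_sigma q i j"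
      using ij by (auto simp: min_over_pairs_eq intro!: Min_le)
    then have "2 * a * (?\<sigma> / ?r i j) ^ 12 \<le> 2 * a * (pair_sigma q i j / ?r i j) ^ 12"
      using r \<sigma> \<open>a > 0\<close> by (intro mult_left_mono power_mono divide_right_mono) auto
    also have "\<dots> \<le> total_potential a q N (x t) + 2 * a * real (N choose 2)"
      using total_potential_lower_bound[OF _ ij, of a q "x t"] \<open>a > 0\<close> by simp
    also have "total_potential a q N (x t) \<le> energy a m q N x t"
      using assms(4) by (auto simp: energy_def less_imp_le intro!: sum_nonneg)
    also have "\<dots> \<le> initial_energy a m q N x"
      using assms(5) by (intro energy_le_initial_energy[OF assms(7) t]) (simp add: less_imp_le)
    finally have le: "2 * a * (?\<sigma> / ?r i j) ^ 12 \<le> ?E"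
      by simp
    have "0 < 2 * a * (?\<sigma> / ?r i j) ^ 12"
      using r \<sigma> \<open>a > 0\<close> by (intro mult_pos_pos zero_less_power divide_pos_pos) auto
    with le have E: "?E > 0"
      by linarith
    have "2 * a * ?\<sigma> ^ 12 / ?E \<le> ?r i j ^ 12"
      using le E r by (simp add: field_simps)
    then have "root 12 (2 * a * ?\<sigma> ^ 12 / ?E) \<le> root 12 (?r i j ^ 12)"
      by (intro real_root_le_mono) auto
    then show ?thesis
      using E r by (simp add: real_root_power_cancel)
  qed
  have "?E > 0"
    using ne * by auto
  then have "root 12 (2 * a * ?\<sigma> ^ 12 / ?E) > 0"
    using \<sigma> \<open>a > 0\<close> by (intro real_root_gt_zero divide_pos_pos mult_pos_pos zero_less_power) auto
  moreover have "root 12 (2 * a * ?\<sigma> ^ 12 / ?E) \<le> min_over_pairs N ?r"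
    using ne * by (auto simp: min_over_pairs_eq)
  ultimately show "min_over_pairs N ?r \<ge> root 12 (2 * a * ?\<sigma> ^ 12 / ?E) \<and>
      root 12 (2 * a * ?\<sigma> ^ 12 / ?E) > 0"
    by blast
qed

end
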